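(* The power sum symmetric functions expand into the basis generated by the family of paths $\{P_n\}_{n\ge1}$ via, for every partition $\lambda$, $$p_\lambda = \sum_{\alpha\preccurlyeq\lambda} (-1)^{|\lambda| - \ell(\alpha)} X_{P_{\widetilde\alpha}}$$ and similarly $$X_{P_\lambda} = \sum_{\alpha\preccurlyeq\lambda} (-1)^{|\lambda| - \ell(\alpha)} p_{\widetilde\alpha}.$$
   Context: A composition $\alpha=(\alpha_1,\dots,\alpha_{\ell(\alpha)})$ is a finite ordered list of positive integers, with length $\ell(\alpha)$ and size $|\alpha|=\sum_i\alpha_i$; a partition is a composition with weakly decreasing parts. $\widetilde\alpha$ is the partition obtained by sorting the parts of $\alpha$ into weakly decreasing order. $\alpha\preccurlyeq\lambda$ means the composition $\alpha$ is a refinement of $\lambda$: the parts of $\lambda$ are obtained in order by adding together adjacent parts of $\alpha$ in order. The sums are over compositions $\alpha$. The power sum symmetric functions are $p_i=\sum_j x_j^i$ and $p_\lambda=\prod_i p_{\lambda_i}$. $P_n$ ($n\ge1$) is the path on $n$ vertices $v_1,\dots,v_n$ with edges $v_iv_{i+1}$, $1\le i\le n-1$, and for a partition $\lambda$, $P_\lambda$ is the disjoint union $P_{\lambda_1}\cup\cdots\cup P_{\lambda_{\ell(\lambda)}}$. The chromatic symmetric function of a graph $G$ with vertices $v_1,\dots,v_n$ is $X_G=\sum_\kappa x_{\kappa(v_1)}\cdots x_{\kappa(v_n)}$, summed over all proper colourings $\kappa:V(G)\to\mathbb{Z}^+$ (maps with $\kappa(u)\ne\kappa(v)$ whenever $uv$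 is an edge). The family $\{X_{P_\lambda}\}_{\lambda\vdash n\ge0}$ is a basis of the algebra of symmetric functions. *)

theory Defs
  imports "HOL-Library.Multiset" "HOL-Library.FuncSet"
begin

section \<open>Formal power series in countably many commuting variables\<close>

text \<open>
  The variables are \<open>x\<^sub>j\<close> for \<open>j :: nat\<close>; only those with \<open>j \<ge> 1\<close> are used below.
  The monomial \<open>x\<^bsub>j\<^sub>1\<^esub> \<cdots> x\<^bsub>j\<^sub>d\<^esub>\<close> is encoded as the multiset \<open>{#j\<^sub>1, \<dots>, j\<^sub>d#}\<close>, so that
  multiplication of monomials is addition of multisets.  A series is a family of coefficients;
  the symmetric functions form a subalgebra of the ring of series.
\<close>

typedef 'a series = "UNIV :: (nat multiset \<Rightarrow> 'a) set"
  morphisms series_coeff Series ..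

lemma series_coeff_Series [simp]: "series_coeff (Series f) m = f m"
  by (simp add: Series_inverse)

lemma series_eqI: "(\<And>m. series_coeff f m = series_coeff g m) \<Longrightarrow> f = g"
  by (metis ext series_coeff_inject)

lemma finite_submultisets: "finite {A. A \<subseteq># (M :: 'b multiset)}"
proof (induction M)
  case empty
  then show ?case by simp
next
  case (add x M)
  have "{A. A \<subseteq># add_mset x M} \<subseteq> {A. A \<subseteq># M} \<union> add_mset x ` {A. A \<subseteq># M}"
  proof
    fix A assume A: "A \<in> {A. A \<subseteq># add_mset x M}"
    show "A \<in> {A. A \<subseteq># M} \<union> add_mset x ` {A. A \<subseteq># M}"
    proof (cases "x \<in># A")
      case True
      then obtain B where "A = add_mset x B" by (meson multi_member_split)
      then show ?thesis using A by auto
    next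
      case False
      then have "A \<subseteq># M" using A
        by (metis add_mset_remove_trivial diff_single_trivial mem_Collect_eq subset_eq_diff_conv
            add_mset_add_single)
      then show ?thesis by simp
    qed
  qed
  then show ?case using add by (meson finite_UnI finite_imageI finite_subset)
qed

lemma finite_mset_splits: "finite {(A, B). A + B = (M :: 'b multiset)}"
proof (rule finite_subset)
  show "{(A, B). A + B = M} \<subseteq> {A. A \<subseteq># M} \<times> {B. B \<subseteq># M}" by auto
qed (simp add: finite_submultisets)

instantiation series :: (comm_ring_1) comm_ring_1
begin

definition zero_series :: "'a series" where
  "0 = Series (\<lambda>m. 0)"

definition one_series :: "'a series" where
  "1 = Series (\<lambda>m. if m = {#} then 1 else 0)"

definition plus_series :: "'a series \<Rightarrow> 'a series \<Rightarrow> 'a series" where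
  "f + g = Series (\<lambda>m. series_coeff f m + series_coeff g m)"

definition minus_series :: "'a series \<Rightarrow> 'a series \<Rightarrow> 'a series" where
  "f - g = Series (\<lambda>m. series_coeff f m - series_coeff g m)"

definition uminus_series :: "'a series \<Rightarrow> 'a series" where
  "- f = Series (\<lambda>m. - series_coeff f m)"

definition times_series :: "'a series \<Rightarrow> 'a series \<Rightarrow> 'a series" where
  "f * g = Series (\<lambda>m. \<Sum>(A, B) \<in> {(A, B). A + B = m}. series_coeff f A * series_coeff g B)"

instance
proof
  fix f g h :: "'a series"
  show "f * g * h = f * (g * h)"
  proof (rule series_eqI)
    fix m :: "nat multiset"
    let ?S = "\<lambda>m :: nat multiset. {(A, B). A + B = m}"
    let ?T = "{(A, B, C). A + B + C = m}"
    let ?t = "\<lambda>(A, B, C). series_coeff f A * series_coeff g B * series_coeff h C"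
    have fin: "finite (?S n)" for n by (rule finite_mset_splits)
    have "series_coeff (f * g * h) m =
        (\<Sum>p\<in>?S m. \<Sum>q\<in>?S (fst p).
           series_coeff f (fst q) * series_coeff g (snd q) * series_coeff h (snd p))"
      by (simp add: times_series_def sum_distrib_right case_prod_beta)
    also have "\<dots> = (\<Sum>(p, q)\<in>Sigma (?S m) (\<lambda>p. ?S (fst p)).
           series_coeff f (fst q) * series_coeff g (snd q) * series_coeff h (snd p))"
      by (rule sum.Sigma) (use fin in auto)
    also have "\<dots> = (\<Sum>t\<in>?T. ?t t)"
      by (rule sum.reindex_bij_witness[where
            j = "\<lambda>(p, q). (fst q, snd q, snd p)" and
            i = "\<lambda>(A, B, C). ((A + B, C), (A, B))"]) auto
    finally have l: "series_coeff (f * g * h) m = (\<Sum>t\<in>?T. ?t t)" .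
    have "series_coeff (f * (g * h)) m =
        (\<Sum>p\<in>?S m. \<Sum>q\<in>?S (snd p).
           series_coeff f (fst p) * series_coeff g (fst q) * series_coeff h (snd q))"
      by (simp add: times_series_def sum_distrib_left case_prod_beta mult.assoc)
    also have "\<dots> = (\<Sum>(p, q)\<in>Sigma (?S m) (\<lambda>p. ?S (snd p)).
           series_coeff f (fst p) * series_coeff g (fst q) * series_coeff h (snd q))"
      by (rule sum.Sigma) (use fin in auto)
    also have "\<dots> = (\<Sum>t\<in>?T. ?t t)"
      by (rule sum.reindex_bij_witness[where
            j = "\<lambda>(p, q). (fst p, fst q, snd q)" and
            i = "\<lambda>(A, B, C). ((A, B + C), (B, C))"]) (auto simp: add.assoc)
    finally show "series_coeff (f * g * h) m = series_coeff (f * (g * h)) m"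
      using l by simp
  qed
  show "f * g = g * f"
  proof (rule series_eqI)
    fix m
    show "series_coeff (f * g) m = series_coeff (g * f) m"
      unfolding times_series_def series_coeff_Series
      by (rule sum.reindex_bij_witness[where
            j = "\<lambda>(A, B). (B, A)" and i = "\<lambda>(A, B). (B, A)"]) (auto simp: ac_simps)
  qed
  show "1 * f = f"
  proof (rule series_eqI)
    fix m :: "nat multiset"
    have "series_coeff (1 * f) m =
        (\<Sum>p\<in>{(A, B). A + B = m}. if p = ({#}, m) then series_coeff f m else 0)"
      unfolding times_series_def series_coeff_Series one_series_def
      by (rule sum.cong) (auto split: if_splits)
    also have "\<dots> = series_coeff f m"
      using finite_mset_splits[of m] by (simp add: sum.delta)
    finally show "series_coeff (1 * f) m = series_coeff f m" .
  qed
  show "(f + g) * h = f * h + g * h"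
    by (rule series_eqI)
      (simp add: times_series_def plus_series_def case_prod_beta distrib_right sum.distrib)
  show "(0 :: 'a series) \<noteq> 1"
  proof
    assume "(0 :: 'a series) = 1"
    then have "series_coeff (0 :: 'a series) {#} = series_coeff 1 {#}" by simp
    then show False by (simp add: zero_series_def one_series_def)
  qed
qed (auto intro!: series_eqI
    simp: plus_series_def minus_series_def uminus_series_def zero_series_def ac_simps)

end

text \<open>
  The infinite formal sum \<open>\<Sum>s\<in>S. mon s\<close> of the monomials \<open>mon s\<close>.  It is
  meaningful when every monomial arises from only finitely many \<open>s \<in> S\<close>; this is shown
  below for the two uses of this definition.
\<close>

definition monomial_sum :: "'s set \<Rightarrow> ('s \<Rightarrow> nat multiset) \<Rightarrow> 'a :: comm_ring_1 series" where
  "monomial_sum S mon = Series (\<lambda>m. of_nat (card {s \<in> S. mon s = m}))"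


section \<open>Power sums\<close>

definition power_sum :: "nat \<Rightarrow> 'a :: comm_ring_1 series" where
  "power_sum i = monomial_sum {1..} (\<lambda>j. replicate_mset i j)"

lemma finite_power_sum_fibre:
  "i \<ge> 1 \<Longrightarrow> finite {j \<in> {1..}. replicate_mset i j = m}"
  by (rule finite_subset[of _ "set_mset m"]) auto

definition power_sums :: "nat list \<Rightarrow> 'a :: comm_ring_1 series" where
  "power_sums l = prod_list (map power_sum l)"


section \<open>Graphs and the chromatic symmetric function\<close>

text \<open>A simple graph is a pair of a vertex set and a set of edges \<open>{u, v}\<close> with \<open>u \<noteq> v\<close>.\<close>

type_synonym 'v graph = "'v set \<times> 'v set set"

abbreviation verts :: "'v graph \<Rightarrow> 'v set" where "verts \<equiv> fst"
abbreviation edges :: "'v graph \<Rightarrow> 'v set set" where "edges \<equiv> snd"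

text \<open>Colourings are extensional functions, so that distinct colourings differ on a vertex.\<close>

definition proper_colourings :: "'v graph \<Rightarrow> ('v \<Rightarrow> nat) set" where
  "proper_colourings G =
     {\<kappa> \<in> verts G \<rightarrow>\<^sub>E {1..}. \<forall>u v. {u, v} \<in> edges G \<longrightarrow> \<kappa> u \<noteq> \<kappa> v}"

definition chromatic_sym :: "'v graph \<Rightarrow> 'a :: comm_ring_1 series" where
  "chromatic_sym G =
     monomial_sum (proper_colourings G) (\<lambda>\<kappa>. image_mset \<kappa> (mset_set (verts G)))"

lemma finite_chromatic_fibre:
  assumes "finite (verts G)"
  shows "finite {\<kappa> \<in> proper_colourings G. image_mset \<kappa> (mset_set (verts G)) = m}"
proof (rule finite_subset)
  show "{\<kappa> \<in> proper_colourings G. image_mset \<kappa> (mset_set (verts G)) = m}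
        \<subseteq> verts G \<rightarrow>\<^sub>E set_mset m"
    using assms by (auto simp: proper_colourings_def PiE_iff extensional_def)
qed (use assms in \<open>auto intro: finite_PiE\<close>)

definition path_graph :: "nat \<Rightarrow> nat graph" where
  "path_graph n = ({1..n}, {{i, i + 1} | i. 1 \<le> i \<and> i + 1 \<le> n})"

text \<open>The vertices of the \<open>k\<close>-th summand of a disjoint union are tagged with \<open>k\<close>.\<close>

definition disjoint_union :: "'v graph list \<Rightarrow> (nat \<times> 'v) graph" where
  "disjoint_union Gs =
     (\<Union>k<length Gs. Pair k ` verts (Gs ! k),
      \<Union>k<length Gs. (`) (Pair k) ` edges (Gs ! k))"

definition paths :: "nat list \<Rightarrow> (nat \<times> nat) graph" where
  "paths l = disjoint_union (map path_graph l)"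


section \<open>Compositions, partitions and refinement\<close>

definition is_composition :: "nat list \<Rightarrow> bool" where
  "is_composition \<alpha> \<longleftrightarrow> (\<forall>a\<in>set \<alpha>. a \<ge> 1)"

definition is_partition :: "nat list \<Rightarrow> bool" where
  "is_partition l \<longleftrightarrow> is_composition l \<and> sorted_wrt (\<ge>) l"

definition sort_partition :: "nat list \<Rightarrow> nat list" where
  "sort_partition \<alpha> = rev (sort \<alpha>)"

text \<open>
  \<open>\<alpha>\<close> refines \<open>\<beta>\<close> if \<open>\<alpha>\<close> can be cut into consecutive nonempty blocks whose sums are, in
  order, the parts of \<open>\<beta>\<close>.
\<close>

definition refines :: "nat list \<Rightarrow> nat list \<Rightarrow> bool" (infix "\<preceq>\<^sub>r" 50) where
  "\<alpha> \<preceq>\<^sub>r \<beta> \<longleftrightarrow> (\<exists>bs. (\<forall>b\<in>set bs. b \<noteq> []) \<and> concat bs = \<alpha> \<and> map sum_list bs = \<beta>)"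

definition refinements :: "nat list \<Rightarrow> nat list set" where
  "refinements \<beta> = {\<alpha>. is_composition \<alpha> \<and> \<alpha> \<preceq>\<^sub>r \<beta>}"

lemma refines_sum_list: "\<alpha> \<preceq>\<^sub>r \<beta> \<Longrightarrow> sum_list \<alpha> = sum_list \<beta>"
proof -
  have "sum_list (concat bs) = sum_list (map sum_list bs)" for bs :: "nat list list"
    by (induction bs) auto
  then show "\<alpha> \<preceq>\<^sub>r \<beta> \<Longrightarrow> sum_list \<alpha> = sum_list \<beta>" by (auto simp: refines_def)
qed

lemma composition_length_le: "is_composition \<alpha> \<Longrightarrow> length \<alpha> \<le> sum_list \<alpha>"
  by (induction \<alpha>) (auto simp: is_composition_def)

text \<open>Hence the natural subtraction \<open>sum_list \<beta> - length \<alpha>\<close> is never truncated for refinements.\<close>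

lemma refinements_length_le: "\<alpha> \<in> refinements \<beta> \<Longrightarrow> length \<alpha> \<le> sum_list \<beta>"
  using composition_length_le refines_sum_list by (fastforce simp: refinements_def)

lemma finite_refinements: "finite (refinements \<beta>)"
proof (rule finite_subset)
  show "refinements \<beta> \<subseteq> {\<alpha>. set \<alpha> \<subseteq> {..sum_list \<beta>} \<and> length \<alpha> \<le> sum_list \<beta>}"
  proof
    fix \<alpha> assume \<alpha>: "\<alpha> \<in> refinements \<beta>"
    then have "sum_list \<alpha> = sum_list \<beta>" by (auto simp: refinements_def refines_sum_list)
    then have "set \<alpha> \<subseteq> {..sum_list \<beta>}" using member_le_sum_list[of _ \<alpha>] by auto
    then show "\<alpha> \<in> {\<alpha>. set \<alpha> \<subseteq> {..sum_list \<beta>} \<and> length \<alpha> \<le> sum_list \<beta>}"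
      using refinements_length_le[OF \<alpha>] by simp
  qed
qed (simp add: finite_lists_length_le)

end

theory Submission
  imports Defs
begin

text \<open>
  Both sides are multiplicative over the parts of \<open>l\<close>, which reduces the claim to a single path.
  Colourings of \<open>P\<^sub>n\<close> are words of length \<open>n\<close> without equal adjacent letters.
  The pairs of a block of \<open>k\<close> equal letters and such a word of length \<open>m\<close> are counted by
  \<open>p\<^sub>k X\<^sub>m\<close>, and splitting them according to whether the word continues the block gives, by
  telescoping, \<open>X\<^sub>n = \<Sum>k=1..n. (-1)\<^sup>k\<^sup>-\<^sup>1 p\<^sub>k X\<^sub>n\<^sub>-\<^sub>k\<close>.  Unfolding this
  recurrence produces the sum over compositions, and since it is symmetric in \<open>X\<close> and \<open>p\<close>, both
  expansions follow.
\<close>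

section \<open>Sums of monomials\<close>

lemma monomial_sum_reindex:
  assumes "bij_betw h S T" and "\<And>s. s \<in> S \<Longrightarrow> g (h s) = f s"
  shows "monomial_sum S f = monomial_sum T g"
proof -
  have "card {s \<in> S. f s = m} = card {t \<in> T. g t = m}" for m
  proof (rule bij_betw_same_card)
    show "bij_betw h {s \<in> S. f s = m} {t \<in> T. g t = m}"
      using assms unfolding bij_betw_def by (auto intro: inj_on_subset)
  qed
  then show ?thesis by (simp add: monomial_sum_def)
qed

text \<open>Coefficients are cardinalities of fibres, and \<open>card\<close> is 0 on infinite sets,
  so additivity rests on the fibres being finite.\<close>

lemma monomial_sum_Un_disjoint:
  assumes "\<And>m. finite {s \<in> S \<union> T. f s = m}" and "S \<inter> T = {}"
  shows "monomial_sum (S \<union> T) f = monomial_sum S f + monomial_sum T f"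
proof (rule series_eqI)
  fix m
  have eq: "{s \<in> S \<union> T. f s = m} = {s \<in> S. f s = m} \<union> {s \<in> T. f s = m}" by auto
  have "card {s \<in> S \<union> T. f s = m} = card {s \<in> S. f s = m} + card {s \<in> T. f s = m}"
    unfolding eq by (rule card_Un_disjoint) (use assms(1)[of m] assms(2) eq in auto)
  then show "series_coeff (monomial_sum (S \<union> T) f) m =
      series_coeff (monomial_sum S f + monomial_sum T f) m"
    by (simp add: monomial_sum_def plus_series_def)
qed

text \<open>The fibre over \<open>m\<close> in the product is the disjoint union, over all
  splittings \<open>A + B = m\<close>, of products of a fibre over \<open>A\<close> and a fibre over
  \<open>B\<close>. Counting it gives exactly the Cauchy product.\<close>

lemma
  assumes S: "\<And>m. finite {s \<in> S. f s = m}" and T: "\<And>m. finite {t \<in> T. g t = m}"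
  shows finite_fibre_times: "finite {p \<in> S \<times> T. f (fst p) + g (snd p) = m}"
    and monomial_sum_times: "monomial_sum S f * monomial_sum T g =
      monomial_sum (S \<times> T) (\<lambda>p. f (fst p) + g (snd p))"
proof -
  let ?F = "\<lambda>(A, B). {s \<in> S. f s = A} \<times> {t \<in> T. g t = B}"
  have eq: "{p \<in> S \<times> T. f (fst p) + g (snd p) = m} = (\<Union>q\<in>{(A, B). A + B = m}. ?F q)" for m
    by auto
  have fin: "finite (?F q)" for q using S T by (cases q) auto
  show "finite {p \<in> S \<times> T. f (fst p) + g (snd p) = m}"
    unfolding eq using fin finite_mset_splits[of m] by blast
  show "monomial_sum S f * monomial_sum T g =
      monomial_sum (S \<times> T) (\<lambda>p. f (fst p) + g (snd p))"
  proof (rule series_eqI)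
    fix m
    have "card {p \<in> S \<times> T. f (fst p) + g (snd p) = m} =
        (\<Sum>q\<in>{(A, B). A + B = m}. card (?F q))"
      unfolding eq by (rule card_UN_disjoint) (use finite_mset_splits[of m] fin in auto)
    also have "\<dots> = (\<Sum>(A, B)\<in>{(A, B). A + B = m}.
        card {s \<in> S. f s = A} * card {t \<in> T. g t = B})"
      by (intro sum.cong) (auto simp: card_cartesian_product)
    finally show "series_coeff (monomial_sum S f * monomial_sum T g) m =
        series_coeff (monomial_sum (S \<times> T) (\<lambda>p. f (fst p) + g (snd p))) m"
      by (simp add: monomial_sum_def times_series_def case_prod_beta)
  qed
qed


section \<open>Disjoint unions of graphs\<close>

text \<open>Relabelling invariance: \<open>?r\<close> pulls a colouring back along \<open>h\<close>
  and \<open>?s\<close> carries it forward along the inverse; both are restricted so that the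
  results stay extensional.\<close>

lemma chromatic_sym_image:
  assumes inj: "inj_on h (verts G)" and e: "\<And>e. e \<in> edges G \<Longrightarrow> e \<subseteq> verts G"
  shows "chromatic_sym (h ` verts G, (`) h ` edges G) = chromatic_sym G"
proof -
  let ?H = "(h ` verts G, (`) h ` edges G)"
  let ?r = "\<lambda>\<kappa>. restrict (\<kappa> \<circ> h) (verts G)"
  let ?s = "\<lambda>\<kappa>. restrict (\<kappa> \<circ> the_inv_into (verts G) h) (h ` verts G)"
  note inv = the_inv_into_f_f[OF inj]
  have "bij_betw ?r (proper_colourings ?H) (proper_colourings G)"
  proof (rule bij_betw_byWitness[where f' = ?s])
    show "\<forall>\<kappa>\<in>proper_colourings ?H. ?s (?r \<kappa>) = \<kappa>"
      by (auto simp: proper_colourings_def PiE_def extensional_def fun_eq_iff restrict_def inv)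
    show "\<forall>\<kappa>\<in>proper_colourings G. ?r (?s \<kappa>) = \<kappa>"
      by (auto simp: proper_colourings_def PiE_def extensional_def fun_eq_iff restrict_def inv)
    show "?r ` proper_colourings ?H \<subseteq> proper_colourings G"
    proof clarify
      fix \<kappa> assume \<kappa>: "\<kappa> \<in> proper_colourings ?H"
      have "?r \<kappa> u \<noteq> ?r \<kappa> v" if uv: "{u, v} \<in> edges G" for u v
      proof -
        have "h ` {u, v} \<in> (`) h ` edges G" using uv by (rule imageI)
        then show ?thesis using \<kappa> e[OF uv] by (auto simp: proper_colourings_def)
      qed
      then show "?r \<kappa> \<in> proper_colourings G"
        using \<kappa> by (auto simp: proper_colourings_def)
    qed
    show "?s ` proper_colourings G \<subseteq> proper_colourings ?H"
    proof clarify
      fix \<kappa> assume \<kappa>: "\<kappa> \<in> proper_colourings G"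
      have "?s \<kappa> u \<noteq> ?s \<kappa> v" if uv: "{u, v} \<in> (`) h ` edges G" for u v
      proof -
        obtain d where d: "{u, v} = h ` d" "d \<in> edges G" using uv by (rule imageE)
        obtain a b where ab: "a \<in> d" "b \<in> d" "u = h a" "v = h b" using d(1) by blast
        \<comment> \<open>Edges lie inside the vertex set, where \<open>h\<close> is injective, so
          an edge can be recovered from its image.\<close>
        have "d = {a, b}"
        proof (rule inj_on_image_eq_iff[THEN iffD1, OF inj])
          show "h ` d = h ` {a, b}" using d(1) ab by auto
        qed (use e[OF d(2)] ab in auto)
        then show ?thesis using \<kappa> d ab e[OF d(2)] by (auto simp: proper_colourings_def inv)
      qed
      then show "?s \<kappa> \<in> proper_colourings ?H"
        using \<kappa> by (auto simp: proper_colourings_def inv PiE_iff)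
    qed
  qed
  moreover have "image_mset (?r \<kappa>) (mset_set (verts G)) =
      image_mset \<kappa> (mset_set (h ` verts G))" for \<kappa> :: "'b \<Rightarrow> nat"
  \<comment> \<open>In the infinite case \<open>mset_set\<close> is empty on both sides, because
    injectivity keeps the image infinite.\<close>
  proof (cases "finite (verts G)")
    case True
    then have "image_mset (?r \<kappa>) (mset_set (verts G)) =
        image_mset \<kappa> (image_mset h (mset_set (verts G)))"
      unfolding multiset.map_comp by (intro image_mset_cong) auto
    then show ?thesis using inj by (simp add: image_mset_mset_set)
  qed (use inj in \<open>simp add: finite_image_iff\<close>)
  ultimately show ?thesis
    unfolding chromatic_sym_def fst_conv by (intro monomial_sum_reindex)
qed

text \<open>No edge joins \<open>V\<close> to \<open>W\<close>, so a proper colouring is the same as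
  an independent pair of proper colourings, and its monomial is the product of theirs.\<close>

lemma chromatic_sym_Un_disjoint:
  assumes fin: "finite V" "finite W" and disj: "V \<inter> W = {}"
    and E: "\<And>e. e \<in> E \<Longrightarrow> e \<subseteq> V" and F: "\<And>e. e \<in> F \<Longrightarrow> e \<subseteq> W"
  shows "(chromatic_sym (V \<union> W, E \<union> F) :: 'a :: comm_ring_1 series) =
    chromatic_sym (V, E) * chromatic_sym (W, F)"
proof -
  let ?r = "\<lambda>\<kappa>. (restrict \<kappa> V, restrict \<kappa> W)"
  let ?s = "\<lambda>p. restrict (\<lambda>x. if x \<in> V then fst p x else snd p x) (V \<union> W)"
  let ?P = "proper_colourings (V \<union> W, E \<union> F)"
  let ?Q = "proper_colourings (V, E) \<times> proper_colourings (W, F)"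
  have bij: "bij_betw ?r ?P ?Q"
  proof (rule bij_betw_byWitness[where f' = ?s])
    show "\<forall>\<kappa>\<in>?P. ?s (?r \<kappa>) = \<kappa>"
      by (auto simp: proper_colourings_def PiE_def extensional_def fun_eq_iff restrict_def)
    show "\<forall>p\<in>?Q. ?r (?s p) = p"
      using disj
      by (auto simp: proper_colourings_def PiE_def extensional_def fun_eq_iff restrict_def)
    show "?r ` ?P \<subseteq> ?Q"
      using E F by (fastforce simp: proper_colourings_def)
    show "?s ` ?Q \<subseteq> ?P"
    proof clarify
      fix \<kappa> \<mu> assume \<kappa>: "\<kappa> \<in> proper_colourings (V, E)" and \<mu>: "\<mu> \<in> proper_colourings (W, F)"
      have "?s (\<kappa>, \<mu>) u \<noteq> ?s (\<kappa>, \<mu>) v" if uv: "{u, v} \<in> E \<union> F" for u v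
      proof (cases "{u, v} \<in> E")
        case True
        then show ?thesis using E[OF True] \<kappa> by (auto simp: proper_colourings_def)
      next
        case False
        then have uvF: "{u, v} \<in> F" using uv by simp
        then show ?thesis using F[OF uvF] disj \<mu> by (auto simp: proper_colourings_def)
      qed
      then show "?s (\<kappa>, \<mu>) \<in> ?P"
        using \<kappa> \<mu> by (auto simp: proper_colourings_def PiE_iff)
    qed
  qed
  have "image_mset (restrict \<kappa> V) (mset_set V) + image_mset (restrict \<kappa> W) (mset_set W) =
      image_mset \<kappa> (mset_set (V \<union> W))" for \<kappa> :: "_ \<Rightarrow> nat"
  proof -
    have "image_mset (restrict \<kappa> V) (mset_set V) = image_mset \<kappa> (mset_set V)"
         "image_mset (restrict \<kappa> W) (mset_set W) = image_mset \<kappa> (mset_set W)"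
      using fin by (auto intro!: image_mset_cong)
    then show ?thesis using fin disj by (simp add: mset_set_Union)
  qed
  then have "(chromatic_sym (V \<union> W, E \<union> F) :: 'a series) = monomial_sum ?Q
      (\<lambda>p. image_mset (fst p) (mset_set V) + image_mset (snd p) (mset_set W))"
    unfolding chromatic_sym_def by (intro monomial_sum_reindex[OF bij]) simp
  also have "\<dots> = (chromatic_sym (V, E) * chromatic_sym (W, F) :: 'a series)"
    unfolding chromatic_sym_def fst_conv
    by (rule monomial_sum_times[symmetric])
      (use fin finite_chromatic_fibre[of "(V, E)"] finite_chromatic_fibre[of "(W, F)"] in auto)
  finally show ?thesis .
qed

text \<open>The empty graph has exactly one extensional colouring, the constantly
  \<open>undefined\<close> function, and its monomial is \<open>{#}\<close>.\<close>

lemma chromatic_sym_disjoint_union_Nil: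
  "(chromatic_sym (disjoint_union ([] :: 'v graph list)) :: 'a :: comm_ring_1 series) = 1"
proof (rule series_eqI)
  fix m
  have "proper_colourings (disjoint_union ([] :: 'v graph list)) = {\<lambda>_. undefined}"
    by (auto simp: proper_colourings_def disjoint_union_def)
  then have "{\<kappa> \<in> proper_colourings (disjoint_union ([] :: 'v graph list)).
      image_mset \<kappa> (mset_set (verts (disjoint_union ([] :: 'v graph list)))) = m} =
      (if m = {#} then {\<lambda>_. undefined} else {})"
    by (auto simp: disjoint_union_def)
  then show "series_coeff (chromatic_sym (disjoint_union ([] :: 'v graph list))) m =
      series_coeff (1 :: 'a series) m"
    by (simp add: chromatic_sym_def monomial_sum_def one_series_def)
qed

text \<open>Putting a graph in front raises the tag of every other summand by one, which is the
  relabelling \<open>map_prod Suc id\<close>.\<close>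

lemma disjoint_union_Cons:
  "disjoint_union (G # Gs) =
    (Pair 0 ` verts G \<union> map_prod Suc id ` verts (disjoint_union Gs),
     (`) (Pair 0) ` edges G \<union> (`) (map_prod Suc id) ` edges (disjoint_union Gs))"
  unfolding disjoint_union_def length_Cons lessThan_Suc_eq_insert_0
  by (simp add: image_UN image_image)

lemma chromatic_sym_disjoint_union_Cons:
  assumes fin: "\<forall>H\<in>set (G # Gs). finite (verts H)"
    and edge: "\<forall>H\<in>set (G # Gs). \<forall>e\<in>edges H. e \<subseteq> verts H"
  shows "(chromatic_sym (disjoint_union (G # Gs)) :: 'a :: comm_ring_1 series) =
    chromatic_sym G * chromatic_sym (disjoint_union Gs)"
proof -
  have finU: "finite (verts (disjoint_union Gs))"
    using fin by (auto simp: disjoint_union_def)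
  have edgeU: "e \<subseteq> verts (disjoint_union Gs)" if "e \<in> edges (disjoint_union Gs)" for e
    using edge that by (fastforce simp: disjoint_union_def)
  have "(chromatic_sym (disjoint_union (G # Gs)) :: 'a series) =
      chromatic_sym (Pair (0 :: nat) ` verts G, (`) (Pair 0) ` edges G) *
      chromatic_sym (map_prod Suc id ` verts (disjoint_union Gs),
        (`) (map_prod Suc id) ` edges (disjoint_union Gs))"
    unfolding disjoint_union_Cons
  proof (rule chromatic_sym_Un_disjoint)
    fix e assume "e \<in> (`) (Pair (0 :: nat)) ` edges G"
    then show "e \<subseteq> Pair 0 ` verts G" using edge by auto
  next
    fix e assume "e \<in> (`) (map_prod Suc id) ` edges (disjoint_union Gs)"
    then show "e \<subseteq> map_prod Suc id ` verts (disjoint_union Gs)" using edgeU by blast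
  qed (use fin finU in auto)
  also have "chromatic_sym (Pair (0 :: nat) ` verts G, (`) (Pair 0) ` edges G) =
      (chromatic_sym G :: 'a series)"
    by (rule chromatic_sym_image) (use edge in \<open>auto intro: inj_onI\<close>)
  also have "chromatic_sym (map_prod Suc id ` verts (disjoint_union Gs),
      (`) (map_prod Suc id) ` edges (disjoint_union Gs)) = (chromatic_sym (disjoint_union Gs) :: 'a series)"
    by (rule chromatic_sym_image) (use edgeU in \<open>auto intro: inj_onI\<close>)
  finally show ?thesis .
qed

lemma chromatic_sym_paths:
  "(chromatic_sym (paths l) :: 'a :: comm_ring_1 series) = (\<Prod>n\<leftarrow>l. chromatic_sym (path_graph n))"
proof (induction l)
  case Nil
  show ?case by (simp add: paths_def chromatic_sym_disjoint_union_Nil)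
next
  case (Cons n l)
  have "(chromatic_sym (disjoint_union (map path_graph (n # l))) :: 'a series) =
      chromatic_sym (path_graph n) * chromatic_sym (disjoint_union (map path_graph l))"
    unfolding list.map
    by (rule chromatic_sym_disjoint_union_Cons) (auto simp: path_graph_def)
  then show ?case using Cons by (simp add: paths_def)
qed


section \<open>The recurrence for paths\<close>

definition proper_words :: "nat \<Rightarrow> nat list set" where
  "proper_words n = {w. length w = n \<and> set w \<subseteq> {1..} \<and> distinct_adj w}"

lemma finite_proper_words_fibre: "finite {w \<in> proper_words n. mset w = m}"
proof (rule finite_subset)
  show "{w \<in> proper_words n. mset w = m} \<subseteq> {w. set w \<subseteq> set_mset m \<and> length w \<le> size m}"
    by auto
qed (simp add: finite_lists_length_le)

lemma chromatic_sym_path_graph: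
  "chromatic_sym (path_graph n) = monomial_sum (proper_words n) mset"
proof -
  let ?r = "\<lambda>\<kappa> :: nat \<Rightarrow> nat. map \<kappa> [1..<Suc n]"
  \<comment> \<open>Vertices are numbered from 1 but list positions from 0, so vertex
    \<open>i\<close> receives the letter at position \<open>i - 1\<close>.\<close>
  let ?s = "\<lambda>w. restrict (\<lambda>i. w ! (i - 1)) {1..n}"
  have edge: "{u, v} \<in> edges (path_graph n) \<longleftrightarrow>
      1 \<le> u \<and> 1 \<le> v \<and> u \<le> n \<and> v \<le> n \<and> (v = Suc u \<or> u = Suc v)" for u v
    by (auto simp: path_graph_def doubleton_eq_iff)
  have "bij_betw ?r (proper_colourings (path_graph n)) (proper_words n)"
  proof (rule bij_betw_byWitness[where f' = ?s])
    show "\<forall>\<kappa>\<in>proper_colourings (path_graph n). ?s (?r \<kappa>) = \<kappa>"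
      by (auto simp: proper_colourings_def path_graph_def PiE_def extensional_def fun_eq_iff
          restrict_def simp del: upt_Suc)
    show "\<forall>w\<in>proper_words n. ?r (?s w) = w"
      by (auto simp: proper_words_def intro!: nth_equalityI simp del: upt_Suc)
    show "?r ` proper_colourings (path_graph n) \<subseteq> proper_words n"
    proof clarify
      fix \<kappa> assume "\<kappa> \<in> proper_colourings (path_graph n)"
      then show "?r \<kappa> \<in> proper_words n"
        unfolding proper_colourings_def proper_words_def edge
        by (auto simp: distinct_adj_conv_nth path_graph_def simp del: upt_Suc)
    qed
    show "?s ` proper_words n \<subseteq> proper_colourings (path_graph n)"
    proof clarify
      fix w assume w: "w \<in> proper_words n"
      have pos: "w ! i \<ge> 1" if "i < n" for i
      proof -
        have "w ! i \<in> set w" using w that by (simp add: proper_words_def)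
        then have "w ! i \<in> {1..}" using w unfolding proper_words_def by blast
        then show ?thesis by simp
      qed
      have ne: "w ! (u - 1) \<noteq> w ! u" if "1 \<le> u" "u < n" for u
        using w that distinct_adj_conv_nth[of w] by (auto simp: proper_words_def dest: spec[of _ "u - 1"])
      have ne': "w ! u \<noteq> w ! (u - 1)" if "1 \<le> u" "u < n" for u
        using ne[OF that] by simp
      show "?s w \<in> proper_colourings (path_graph n)"
        unfolding proper_colourings_def edge using pos ne ne'
        by (auto simp: path_graph_def)
    qed
  qed
  moreover have "mset (?r \<kappa>) = image_mset \<kappa> (mset_set (verts (path_graph n)))" for \<kappa>
  proof -
    have "mset [1..<Suc n] = mset_set {1..n}"
      by (metis atLeastLessThanSuc_atLeastAtMost mset_upt)
    then show ?thesis by (simp add: path_graph_def del: upt_Suc)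
  qed
  ultimately show ?thesis unfolding chromatic_sym_def by (intro monomial_sum_reindex)
qed

text \<open>
  A pair \<open>(j, w)\<close> stands for the word \<open>replicate k j @ w\<close>; it belongs to
  \<^term>\<open>broken_blocks m\<close> if the block of \<open>k\<close> letters does not continue into \<open>w\<close>.
\<close>

definition broken_blocks :: "nat \<Rightarrow> (nat \<times> nat list) set" where
  "broken_blocks m = {(j, w). j \<ge> 1 \<and> w \<in> proper_words m \<and> (w = [] \<or> hd w \<noteq> j)}"

definition broken_block_sum :: "nat \<Rightarrow> nat \<Rightarrow> 'a :: comm_ring_1 series" where
  "broken_block_sum k m =
     monomial_sum (broken_blocks m) (\<lambda>p. replicate_mset k (fst p) + mset (snd p))"

text \<open>Splitting off the first letter of a nonempty proper word leaves a proper word that does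
  not begin with that letter, so the letter is a broken block of length 1.\<close>

lemma chromatic_sym_path_graph_Suc: "chromatic_sym (path_graph (Suc m)) = broken_block_sum 1 m"
proof -
  let ?h = "\<lambda>(j, w). j # w"
  have "proper_words (Suc m) \<subseteq> ?h ` broken_blocks m"
  proof
    fix v assume v: "v \<in> proper_words (Suc m)"
    then obtain j w where "v = j # w" by (cases v) (auto simp: proper_words_def)
    then show "v \<in> ?h ` broken_blocks m"
      using v by (auto simp: proper_words_def broken_blocks_def distinct_adj_Cons
          intro!: image_eqI[of _ _ "(j, w)"])
  qed
  then have "bij_betw ?h (broken_blocks m) (proper_words (Suc m))"
    unfolding bij_betw_def
    by (auto simp: inj_on_def proper_words_def broken_blocks_def distinct_adj_Cons)
  then show ?thesis
    unfolding chromatic_sym_path_graph broken_block_sum_def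
    by (intro monomial_sum_reindex[symmetric]) auto
qed

text \<open>The bound \<open>k \<ge> 1\<close> makes the fibres of the power sum finite; for
  \<open>k = 0\<close> every \<open>j\<close> would give the empty monomial.\<close>

lemma
  assumes "k \<ge> 1"
  shows finite_block_fibre:
      "finite {p \<in> {1..} \<times> proper_words m. replicate_mset k (fst p) + mset (snd p) = M}"
    and power_sum_times_path: "power_sum k * chromatic_sym (path_graph m) =
      monomial_sum ({1..} \<times> proper_words m) (\<lambda>p. replicate_mset k (fst p) + mset (snd p))"
  unfolding power_sum_def chromatic_sym_path_graph
  by (rule finite_fibre_times monomial_sum_times finite_power_sum_fibre[OF assms]
      finite_proper_words_fibre)+

text \<open>Base case of the telescoping: the word is empty, so no block can continue into
  it.\<close>

lemma power_sum_times_path_0: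
  assumes "k \<ge> 1"
  shows "power_sum k * chromatic_sym (path_graph 0) = broken_block_sum k 0"
proof -
  have "{1..} \<times> proper_words 0 = broken_blocks 0"
    by (auto simp: broken_blocks_def proper_words_def)
  then show ?thesis
    by (simp add: power_sum_times_path[OF assms] broken_block_sum_def)
qed

text \<open>Either the word does not start with the block's letter \<open>j\<close>, or its first
  letter extends the block to length \<open>Suc k\<close>. In the second case the tail cannot start
  with \<open>j\<close> again, since the word is proper, so the longer block is broken.\<close>

lemma power_sum_times_path_Suc:
  assumes "k \<ge> 1"
  shows "(power_sum k * chromatic_sym (path_graph (Suc m)) :: 'a :: comm_ring_1 series) =
    broken_block_sum k (Suc m) + broken_block_sum (Suc k) m"
proof -
  let ?U = "{(j, w). j \<ge> 1 \<and> w \<in> proper_words (Suc m) \<and> w \<noteq> [] \<and> hd w = j}"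
  let ?f = "\<lambda>k p. replicate_mset k (fst p) + mset (snd p)"
  \<comment> \<open>This map returns one letter from the longer block to the word; the combined
    multiset of letters does not change.\<close>
  let ?h = "\<lambda>(j, w). (j, j # w)"
  have eq: "{1..} \<times> proper_words (Suc m) = broken_blocks (Suc m) \<union> ?U"
    by (auto simp: broken_blocks_def)
  have "(monomial_sum ({1..} \<times> proper_words (Suc m)) (?f k) :: 'a series) =
      monomial_sum (broken_blocks (Suc m)) (?f k) + monomial_sum ?U (?f k)"
    unfolding eq
  proof (rule monomial_sum_Un_disjoint)
    show "finite {p \<in> broken_blocks (Suc m) \<union> ?U. ?f k p = M}" for M
      using finite_block_fibre[OF assms, of "Suc m" M] unfolding eq .
  qed (auto simp: broken_blocks_def)
  moreover have "(monomial_sum ?U (?f k) :: 'a series) = monomial_sum (broken_blocks m) (?f (Suc k))"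
  proof -
    have "?U \<subseteq> ?h ` broken_blocks m"
    proof clarify
      fix v assume v: "v \<in> proper_words (Suc m)" "v \<noteq> []" "hd v \<ge> 1"
      then obtain j w where "v = j # w" by (cases v) auto
      then show "(hd v, v) \<in> ?h ` broken_blocks m"
        using v by (auto simp: proper_words_def broken_blocks_def distinct_adj_Cons
            intro!: image_eqI[of _ _ "(j, w)"])
    qed
    then have "bij_betw ?h (broken_blocks m) ?U"
      unfolding bij_betw_def
      by (auto simp: inj_on_def proper_words_def broken_blocks_def distinct_adj_Cons)
    then show ?thesis by (intro monomial_sum_reindex[symmetric]) auto
  qed
  ultimately show ?thesis
    by (simp add: power_sum_times_path[OF assms] broken_block_sum_def)
qed

text \<open>Solving the previous identity for the first broken sum trades word length for block
  length with a sign change. Iterating until the word is empty gives the alternating sum, hence the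
  induction on \<open>m\<close> with \<open>k\<close> arbitrary.\<close>

lemma broken_block_sum_eq:
  assumes "k \<ge> 1"
  shows "(broken_block_sum k m :: 'a :: comm_ring_1 series) =
    (\<Sum>i\<le>m. (-1) ^ i * power_sum (k + i) * chromatic_sym (path_graph (m - i)))"
  using assms
proof (induction m arbitrary: k)
  case 0
  then show ?case by (simp add: power_sum_times_path_0)
next
  case (Suc m)
  have "(broken_block_sum k (Suc m) :: 'a series) =
      power_sum k * chromatic_sym (path_graph (Suc m)) - broken_block_sum (Suc k) m"
    using Suc.prems by (simp add: power_sum_times_path_Suc)
  then show ?case
    using Suc by (simp add: sum.atMost_Suc_shift sum_negf del: sum.atMost_Suc)
qed

lemma chromatic_sym_path_graph_rec:
  "chromatic_sym (path_graph (Suc m)) =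
    (\<Sum>i\<le>m. (-1) ^ i * power_sum (Suc i) * chromatic_sym (path_graph (m - i)))"
  by (simp add: chromatic_sym_path_graph_Suc broken_block_sum_eq)

lemma chromatic_sym_path_graph_0: "chromatic_sym (path_graph 0) = 1"
proof -
  have "{w \<in> proper_words 0. mset w = m} = (if m = {#} then {[]} else {})" for m
    by (auto simp: proper_words_def)
  then show ?thesis
    unfolding chromatic_sym_path_graph monomial_sum_def one_series_def
    by (intro arg_cong[of _ _ Series]) auto
qed


section \<open>Sums over compositions and refinements\<close>

definition compositions :: "nat \<Rightarrow> nat list set" where
  "compositions n = {\<alpha>. is_composition \<alpha> \<and> sum_list \<alpha> = n}"

lemma compositions_0: "compositions 0 = {[]}"
proof -
  have "\<alpha> = []" if "is_composition \<alpha>" "sum_list \<alpha> = 0" for \<alpha>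
    using composition_length_le[OF that(1)] that(2) by simp
  then show ?thesis by (auto simp: compositions_def is_composition_def)
qed

text \<open>The first part is split off; it is positive, hence of the form
  \<open>Suc i\<close>.\<close>

lemma compositions_Suc:
  "compositions (Suc m) = (\<lambda>(i, \<alpha>). Suc i # \<alpha>) ` Sigma {..m} (\<lambda>i. compositions (m - i))"
proof
  show "compositions (Suc m) \<subseteq> (\<lambda>(i, \<alpha>). Suc i # \<alpha>) ` Sigma {..m} (\<lambda>i. compositions (m - i))"
  proof
    fix \<beta> assume \<beta>: "\<beta> \<in> compositions (Suc m)"
    then obtain a \<alpha> where a: "\<beta> = a # \<alpha>" by (cases \<beta>) (auto simp: compositions_def)
    then obtain i where "a = Suc i" using \<beta> by (cases a) (auto simp: compositions_def is_composition_def)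
    then show "\<beta> \<in> (\<lambda>(i, \<alpha>). Suc i # \<alpha>) ` Sigma {..m} (\<lambda>i. compositions (m - i))"
      using \<beta> a by (auto simp: compositions_def is_composition_def intro!: image_eqI[of _ _ "(i, \<alpha>)"])
  qed
qed (auto simp: compositions_def is_composition_def)

lemma finite_compositions: "finite (compositions n)"
proof (induction n rule: less_induct)
  case (less n)
  then show ?case by (cases n) (auto simp: compositions_0 compositions_Suc)
qed

text \<open>Splitting off the first part shows that the sum over compositions obeys the same
  recurrence as \<open>f\<close>, with the same initial value.\<close>

lemma sum_compositions_unique:
  fixes f :: "nat \<Rightarrow> 'a :: comm_ring_1"
  assumes "f 0 = 1" and rec: "\<And>m. f (Suc m) = (\<Sum>i\<le>m. h (Suc i) * f (m - i))"
  shows "(\<Sum>\<alpha>\<in>compositions n. \<Prod>a\<leftarrow>\<alpha>. h a) = f n"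
proof (induction n rule: less_induct)
  case (less n)
  show ?case
  proof (cases n)
    case 0
    then show ?thesis using assms(1) by (simp add: compositions_0)
  next
    case (Suc m)
    have "(\<Sum>\<alpha>\<in>compositions n. \<Prod>a\<leftarrow>\<alpha>. h a) =
        (\<Sum>(i, \<alpha>)\<in>Sigma {..m} (\<lambda>i. compositions (m - i)). h (Suc i) * (\<Prod>a\<leftarrow>\<alpha>. h a))"
      unfolding Suc compositions_Suc
      by (subst sum.reindex) (auto simp: inj_on_def intro!: sum.cong)
    also have "\<dots> = (\<Sum>i\<le>m. h (Suc i) * (\<Sum>\<alpha>\<in>compositions (m - i). \<Prod>a\<leftarrow>\<alpha>. h a))"
      by (subst sum.Sigma[symmetric]) (auto simp: finite_compositions sum_distrib_left)
    also have "\<dots> = f n" unfolding Suc rec using less Suc by (intro sum.cong) auto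
    finally show ?thesis .
  qed
qed

section \<open>Refinements as concatenations of compositions of the parts\<close>

lemma refinements_Nil: "refinements [] = {[]}"
  by (auto simp: refinements_def refines_def is_composition_def)

text \<open>The first block of a refinement is a composition of \<open>n\<close> and the remaining
  blocks refine \<open>l\<close>. Positivity of \<open>n\<close> ensures that the first block is
  nonempty, as \<open>refines\<close> demands.\<close>

lemma refinements_Cons:
  assumes "n \<ge> 1"
  shows "refinements (n # l) = (\<lambda>(\<alpha>, \<beta>). \<alpha> @ \<beta>) ` (compositions n \<times> refinements l)"
proof
  show "refinements (n # l) \<subseteq> (\<lambda>(\<alpha>, \<beta>). \<alpha> @ \<beta>) ` (compositions n \<times> refinements l)"
  proof
    fix \<gamma> assume \<gamma>: "\<gamma> \<in> refinements (n # l)"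
    then have "\<gamma> \<preceq>\<^sub>r n # l" by (simp add: refinements_def)
    then obtain bs where bs: "\<forall>b\<in>set bs. b \<noteq> []" "concat bs = \<gamma>" "map sum_list bs = n # l"
      unfolding refines_def by (elim exE conjE) (rule that)
    obtain b cs where "bs = b # cs" using bs(3) by (cases bs) simp_all
    show "\<gamma> \<in> (\<lambda>(\<alpha>, \<beta>). \<alpha> @ \<beta>) ` (compositions n \<times> refinements l)"
    proof (rule image_eqI[of _ _ "(b, concat cs)"])
      have "is_composition b" "is_composition (concat cs)"
        using \<gamma> bs(2) \<open>bs = b # cs\<close> by (auto simp: refinements_def is_composition_def)
      moreover have "concat cs \<preceq>\<^sub>r l"
        using bs \<open>bs = b # cs\<close> unfolding refines_def by (intro exI[of _ cs]) auto
      ultimately show "(b, concat cs) \<in> compositions n \<times> refinements l"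
        using bs(3) \<open>bs = b # cs\<close> by (simp add: refinements_def compositions_def)
    qed (use bs(2) \<open>bs = b # cs\<close> in simp)
  qed
  show "(\<lambda>(\<alpha>, \<beta>). \<alpha> @ \<beta>) ` (compositions n \<times> refinements l) \<subseteq> refinements (n # l)"
  proof clarify
    fix \<alpha> \<beta> assume \<alpha>: "\<alpha> \<in> compositions n" and \<beta>: "\<beta> \<in> refinements l"
    have "\<beta> \<preceq>\<^sub>r l" using \<beta> by (simp add: refinements_def)
    then obtain bs where bs: "\<forall>b\<in>set bs. b \<noteq> []" "concat bs = \<beta>" "map sum_list bs = l"
      unfolding refines_def by (elim exE conjE) (rule that)
    have "\<alpha> \<noteq> []" using \<alpha> assms by (auto simp: compositions_def)
    then have "\<alpha> @ \<beta> \<preceq>\<^sub>r n # l"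
      using \<alpha> bs unfolding refines_def by (intro exI[of _ "\<alpha> # bs"]) (auto simp: compositions_def)
    then show "\<alpha> @ \<beta> \<in> refinements (n # l)"
      using \<alpha> \<beta> by (auto simp: refinements_def compositions_def is_composition_def)
  qed
qed

text \<open>Since all parts are positive, a list has at most one prefix that is a composition of
  \<open>n\<close>.\<close>

lemma inj_on_append_compositions: "inj_on (\<lambda>(\<alpha>, \<beta>). \<alpha> @ \<beta>) (compositions n \<times> B)"
proof -
  have uniq: "\<alpha> = \<alpha>' \<and> \<beta> = \<beta>'"
    if "\<alpha> \<in> compositions n" "\<alpha>' \<in> compositions n" "\<alpha> @ \<beta> = \<alpha>' @ \<beta>'" for \<alpha> \<alpha>' \<beta> \<beta>'
  proof -
    \<comment> \<open>If one prefix extends the other, the extra parts are positive and sum to 0, so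
      there are none.\<close>
    have nil: "\<gamma> = []" if "\<delta> \<in> compositions n" "\<delta> @ \<gamma> \<in> compositions n" for \<delta> \<gamma>
    proof -
      have "\<gamma> \<in> compositions 0" using that by (auto simp: compositions_def is_composition_def)
      then show ?thesis by (simp add: compositions_0)
    qed
    show ?thesis using that by (auto simp: append_eq_append_conv2 dest: nil)
  qed
  show ?thesis
  proof (rule inj_onI)
    fix p q assume "p \<in> compositions n \<times> B" "q \<in> compositions n \<times> B"
      and "(case p of (\<alpha>, \<beta>) \<Rightarrow> \<alpha> @ \<beta>) = (case q of (\<alpha>, \<beta>) \<Rightarrow> \<alpha> @ \<beta>)"
    then show "p = q"
      using uniq[of "fst p" "fst q" "snd p" "snd q"]
      by (simp add: case_prod_beta mem_Times_iff prod_eq_iff)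
  qed
qed

text \<open>Distributivity: expanding the product chooses one composition for each part of
  \<open>l\<close>, and concatenating the choices yields each refinement exactly once.\<close>

lemma sum_refinements:
  fixes h :: "nat \<Rightarrow> 'a :: comm_ring_1"
  assumes "is_composition l"
  shows "(\<Sum>\<alpha>\<in>refinements l. \<Prod>a\<leftarrow>\<alpha>. h a) =
    (\<Prod>n\<leftarrow>l. \<Sum>\<alpha>\<in>compositions n. \<Prod>a\<leftarrow>\<alpha>. h a)"
  using assms
proof (induction l)
  case Nil
  show ?case by (simp add: refinements_Nil)
next
  case (Cons n l)
  have n: "n \<ge> 1" and l: "is_composition l" using Cons.prems by (auto simp: is_composition_def)
  have "(\<Sum>\<alpha>\<in>refinements (n # l). \<Prod>a\<leftarrow>\<alpha>. h a) =
      (\<Sum>(\<alpha>, \<beta>)\<in>compositions n \<times> refinements l. (\<Prod>a\<leftarrow>\<alpha>. h a) * (\<Prod>a\<leftarrow>\<beta>. h a))"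
    unfolding refinements_Cons[OF n]
    by (subst sum.reindex[OF inj_on_append_compositions]) (auto intro!: sum.cong)
  also have "\<dots> = (\<Sum>\<alpha>\<in>compositions n. \<Prod>a\<leftarrow>\<alpha>. h a) * (\<Sum>\<beta>\<in>refinements l. \<Prod>a\<leftarrow>\<beta>. h a)"
    by (simp add: sum_product sum.cartesian_product)
  finally show ?case using Cons.IH[OF l] by simp
qed

section \<open>Signs, sorting and the expansion obtained from a recurrence\<close>

text \<open>The exponents \<open>a - 1\<close> add up to size minus length; no subtraction is
  truncated because every part is at least 1.\<close>

lemma prod_list_signed_parts:
  fixes g :: "nat \<Rightarrow> 'a :: comm_ring_1"
  assumes "is_composition \<alpha>"
  shows "(\<Prod>a\<leftarrow>\<alpha>. (-1) ^ (a - 1) * g a) = (-1) ^ (sum_list \<alpha> - length \<alpha>) * (\<Prod>a\<leftarrow>\<alpha>. g a)"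
  using assms
proof (induction \<alpha>)
  case (Cons a \<alpha>)
  then have a: "a \<ge> 1" and \<alpha>: "is_composition \<alpha>" by (auto simp: is_composition_def)
  have "sum_list (a # \<alpha>) - length (a # \<alpha>) = (a - 1) + (sum_list \<alpha> - length \<alpha>)"
    using a composition_length_le[OF \<alpha>] by simp
  then show ?case using Cons.IH[OF \<alpha>] by (simp add: power_add mult_ac)
qed simp

lemma prod_list_sort_partition:
  fixes g :: "nat \<Rightarrow> 'a :: comm_monoid_mult"
  shows "(\<Prod>a\<leftarrow>sort_partition \<alpha>. g a) = (\<Prod>a\<leftarrow>\<alpha>. g a)"
proof -
  have "mset (map g (sort_partition \<alpha>)) = mset (map g \<alpha>)" by (simp add: sort_partition_def)
  then show ?thesis by (metis prod_mset_prod_list)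
qed

text \<open>The recurrence has weights \<open>h a = (-1) ^ (a - 1) * g a\<close>. Unfolding it for
  each part of \<open>l\<close> and multiplying gives a sum over refinements; the signs are then
  collected and the parts sorted. Keeping \<open>f\<close> and \<open>g\<close> abstract lets one
  statement serve both expansions.\<close>

lemma refinement_expansion:
  fixes f g :: "nat \<Rightarrow> 'a :: comm_ring_1"
  assumes l: "is_composition l" and "f 0 = 1"
    and rec: "\<And>m. f (Suc m) = (\<Sum>i\<le>m. (-1) ^ i * g (Suc i) * f (m - i))"
  shows "(\<Prod>n\<leftarrow>l. f n) = (\<Sum>\<alpha>\<in>refinements l.
    (-1) ^ (sum_list l - length \<alpha>) * (\<Prod>a\<leftarrow>sort_partition \<alpha>. g a))"
proof -
  have "(\<Prod>n\<leftarrow>l. f n) = (\<Sum>\<alpha>\<in>refinements l. \<Prod>a\<leftarrow>\<alpha>. (-1) ^ (a - 1) * g a)"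
    unfolding sum_refinements[OF l]
    by (subst sum_compositions_unique[where f = f]) (use assms in auto)
  also have "\<dots> = (\<Sum>\<alpha>\<in>refinements l.
      (-1) ^ (sum_list l - length \<alpha>) * (\<Prod>a\<leftarrow>sort_partition \<alpha>. g a))"
  proof (rule sum.cong)
    fix \<alpha> assume "\<alpha> \<in> refinements l"
    then have "is_composition \<alpha>" and "sum_list \<alpha> = sum_list l"
      by (auto simp: refinements_def refines_sum_list)
    then show "(\<Prod>a\<leftarrow>\<alpha>. (-1) ^ (a - 1) * g a) =
        (-1) ^ (sum_list l - length \<alpha>) * (\<Prod>a\<leftarrow>sort_partition \<alpha>. g a)"
      by (simp only: prod_list_signed_parts prod_list_sort_partition)
  qed simp
  finally show ?thesis .
qed

text \<open>
  The hypothesis and the conclusion both say that the generating functions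
  \<open>\<Sum>n. (-1)\<^sup>n f n t\<^sup>n\<close> and \<open>\<Sum>n. g n t\<^sup>n\<close> are inverse to each other.
\<close>

lemma alternating_recurrence_swap:
  fixes f g :: "nat \<Rightarrow> 'a :: comm_ring_1"
  assumes "f 0 = 1" "g 0 = 1"
    and rec: "\<And>m. f (Suc m) = (\<Sum>i\<le>m. (-1) ^ i * g (Suc i) * f (m - i))"
  shows "g (Suc m) = (\<Sum>i\<le>m. (-1) ^ i * f (Suc i) * g (m - i))"
proof -
  \<comment> \<open>This is the coefficient at degree \<open>Suc m\<close> of the product of the two
    generating functions; it is computed in two ways.\<close>
  let ?c = "\<Sum>i\<le>Suc m. (-1) ^ i * f i * g (Suc m - i)"
  have "(-1) ^ m * f (Suc m) = (\<Sum>i\<le>m. (-1) ^ m * ((-1) ^ (m - i) * g (Suc (m - i)) * f i))"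
    unfolding rec sum_distrib_left
    \<comment> \<open>The order of summation is reversed so that the index now belongs to
      \<open>f\<close>.\<close>
    by (rule sum.reindex_bij_witness[where i = "\<lambda>i. m - i" and j = "\<lambda>i. m - i"]) auto
  also have "\<dots> = (\<Sum>i\<le>m. (-1) ^ i * f i * g (Suc m - i))"
  proof (rule sum.cong)
    fix i assume "i \<in> {..m}"
    \<comment> \<open>With \<open>m = i + d\<close> the total sign is
      \<open>(-1) ^ (i + 2 * d)\<close>, which is \<open>(-1) ^ i\<close>.\<close>
    then obtain d where m: "m = i + d" using le_Suc_ex by auto
    show "(-1) ^ m * ((-1) ^ (m - i) * g (Suc (m - i)) * f i) = (-1) ^ i * f i * g (Suc m - i)"
      unfolding m by (simp add: power_add Suc_diff_le mult_ac)
  qed simp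
  \<comment> \<open>The top term of \<open>?c\<close> is \<open>(-1) ^ Suc m * f (Suc m)\<close>
    because \<open>g 0 = 1\<close>, and it cancels the sum just computed.\<close>
  finally have "?c = 0" using assms(2) by simp
  \<comment> \<open>Here the bottom term is split off instead; it equals \<open>g (Suc m)\<close>
    because \<open>f 0 = 1\<close>.\<close>
  moreover have "?c = g (Suc m) - (\<Sum>i\<le>m. (-1) ^ i * f (Suc i) * g (m - i))"
    using assms(1) by (simp add: sum.atMost_Suc_shift sum_negf del: sum.atMost_Suc)
  ultimately show ?thesis by simp
qed

theorem proposition6p4:
  fixes l :: "nat list"
  assumes "is_partition l"
  shows "(power_sums l :: 'a :: comm_ring_1 series) =
           (\<Sum>\<alpha>\<in>refinements l.
              (-1) ^ (sum_list l - length \<alpha>) * chromatic_sym (paths (sort_partition \<alpha>))) \<and>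
         (chromatic_sym (paths l) :: 'a series) =
           (\<Sum>\<alpha>\<in>refinements l.
              (-1) ^ (sum_list l - length \<alpha>) * power_sums (sort_partition \<alpha>))"
proof
  have l: "is_composition l" using assms by (simp add: is_partition_def)
  let ?X = "\<lambda>n. chromatic_sym (path_graph n) :: 'a series"
  \<comment> \<open>\<^term>\<open>power_sum 0\<close> is the junk value \<open>0\<close>, whereas the recurrence needs \<open>1\<close> at \<open>0\<close>.\<close>
  let ?p = "(power_sum :: nat \<Rightarrow> 'a series)(0 := 1)"
  have X0: "?X 0 = 1" and p0: "?p 0 = 1" by (simp_all add: chromatic_sym_path_graph_0)
  have rec: "?X (Suc m) = (\<Sum>i\<le>m. (-1) ^ i * ?p (Suc i) * ?X (m - i))" for m
    by (simp add: chromatic_sym_path_graph_rec)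
  \<comment> \<open>Parts of a composition are positive, so the changed value at 0 is never
    evaluated.\<close>
  have p: "power_sums \<alpha> = (\<Prod>a\<leftarrow>\<alpha>. ?p a)" if "is_composition \<alpha>" for \<alpha>
    using that by (auto simp: power_sums_def is_composition_def intro!: arg_cong[of _ _ prod_list])
  have sorted: "is_composition (sort_partition \<alpha>)" if "\<alpha> \<in> refinements l" for \<alpha>
    using that by (simp add: refinements_def is_composition_def sort_partition_def)
  show "(power_sums l :: 'a series) = (\<Sum>\<alpha>\<in>refinements l.
      (-1) ^ (sum_list l - length \<alpha>) * chromatic_sym (paths (sort_partition \<alpha>)))"
    unfolding p[OF l] chromatic_sym_paths
    \<comment> \<open>The roles are exchanged here: the swapped recurrence expands \<open>?p\<close>
      in terms of \<open>?X\<close>.\<close>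
    by (rule refinement_expansion[OF l p0 alternating_recurrence_swap[of ?X ?p, OF X0 p0 rec]])
  show "(chromatic_sym (paths l) :: 'a series) = (\<Sum>\<alpha>\<in>refinements l.
      (-1) ^ (sum_list l - length \<alpha>) * power_sums (sort_partition \<alpha>))"
    unfolding chromatic_sym_paths refinement_expansion[of l ?X ?p, OF l X0 rec]
    by (intro sum.cong) (simp_all add: p sorted del: fun_upd_apply)
qed

end
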